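(* Let $x[0]\le\cdots\le x[n-1]$ and $y[0]\le\cdots\le y[n-1]$ be real numbers. Algorithm 1 (described in the context) returns a list containing every sum $x[i]+y[j]$, $0\le i,j\le n-1$, exactly once (as a multiset of $n^2$ entries), arranged in non-decreasing order.
   Context: Algorithm 1 (sumset sorting). Input: arrays $x[0..n-1]$, $y[0..n-1]$ sorted in non-decreasing order. Initialize an empty list $Z$ (0-indexed), set $\mathrm{low}[i]\leftarrow x[i]+y[0]$ for each $i$, and $ip\leftarrow 0$. For $i=0,\dots,n-1$ (row $i$): set $cp\leftarrow ip$; then for $j=0,\dots,n-1$: let $sum\leftarrow x[i]+y[j]$; while $cp<|Z|$ and $Z[cp]\le sum$, set $cp\leftarrow cp+1$; insert $sum$ into $Z$ at position $cp$ (shifting later elements one position to the right); if $i+1<n$ and $sum\le \mathrm{low}[i+1]$, set $ip\leftarrow cp$. Finally return $Z$. *)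

theory Defs
  imports Complex_Main "HOL-Library.Multiset" "HOL-Library.While_Combinator"
begin

definition insert_at :: "nat \<Rightarrow> 'a \<Rightarrow> 'a list \<Rightarrow> 'a list" where
  "insert_at p a Z = take p Z @ a # drop p Z"

definition advance :: "real list \<Rightarrow> real \<Rightarrow> nat \<Rightarrow> nat" where
  "advance Z s cp = while (\<lambda>cp. cp < length Z \<and> Z ! cp \<le> s) (\<lambda>cp. cp + 1) cp"

text \<open>The state of the inner loop is \<open>(Z, ip, cp)\<close>.\<close>

definition inner_step ::
  "nat \<Rightarrow> real list \<Rightarrow> real list \<Rightarrow> real list \<Rightarrow> nat \<Rightarrow> nat \<Rightarrow>
    real list \<times> nat \<times> nat \<Rightarrow> real list \<times> nat \<times> nat" where
  "inner_step n x y low i j = (\<lambda>(Z, ip, cp).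
     let s = x ! i + y ! j;
         cp' = advance Z s cp;
         Z' = insert_at cp' s Z;
         ip' = (if i + 1 < n \<and> s \<le> low ! (i + 1) then cp' else ip)
     in (Z', ip', cp'))"

text \<open>The state of the outer loop is \<open>(Z, ip)\<close>; \<open>cp\<close> is reset to \<open>ip\<close> at the start of each row.\<close>

definition row_step ::
  "nat \<Rightarrow> real list \<Rightarrow> real list \<Rightarrow> real list \<Rightarrow> nat \<Rightarrow>
    real list \<times> nat \<Rightarrow> real list \<times> nat" where
  "row_step n x y low i = (\<lambda>(Z, ip).
     let (Z', ip', cp') = fold (inner_step n x y low i) [0..<n] (Z, ip, ip)
     in (Z', ip'))"

definition sumset_sort :: "nat \<Rightarrow> real list \<Rightarrow> real list \<Rightarrow> real list" where
  "sumset_sort n x y =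
     (let low = map (\<lambda>i. x ! i + y ! 0) [0..<n];
          (Z, ip) = fold (row_step n x y low) [0..<n] ([], 0)
      in Z)"

end

theory Submission
  imports Defs
begin

text \<open>Both pointers only ever skip entries that are harmless: everything in front of \<open>cp\<close> is at most
  the next sum of the current row, and everything in front of \<open>ip\<close> is at most the first sum of
  every later row. Insertions happen at or behind both pointers, so they do not disturb
  these prefixes, and each insertion position separates the entries at most \<open>sum\<close> from the larger ones.\<close>

definition prefix_le :: "nat \<Rightarrow> 'a::linorder list \<Rightarrow> 'a \<Rightarrow> bool" where
  "prefix_le p Z s \<longleftrightarrow> (\<forall>a \<in> set (take p Z). a \<le> s)"

lemma prefix_le_0 [simp]: "prefix_le 0 Z s"
  by (simp add: prefix_le_def)

lemma prefix_le_mono: "prefix_le p Z s \<Longrightarrow> s \<le> t \<Longrightarrow> prefix_le p Z t"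
  by (auto simp: prefix_le_def)

lemma prefix_le_Suc: "p < length Z \<Longrightarrow> prefix_le p Z s \<Longrightarrow> Z ! p \<le> s \<Longrightarrow> prefix_le (Suc p) Z s"
  by (auto simp: prefix_le_def take_Suc_conv_app_nth)

lemma mset_insert_at [simp]: "mset (insert_at p a Z) = add_mset a (mset Z)"
  by (metis append_take_drop_id insert_at_def mset.simps(2) mset_append union_mset_add_mset_right)

lemma length_insert_at [simp]: "length (insert_at p a Z) = Suc (length Z)"
  by (metis mset_insert_at size_add_mset size_mset)

text \<open>The new entry lands at index \<open>q\<close>, outside the first \<open>p\<close>
  positions even if \<open>p = q\<close>. The bound on \<open>q\<close> matters: past the end, the
  entry would be appended at index \<open>length Z\<close> and could fall inside the prefix.\<close>

lemma prefix_le_insert_at: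
  "p \<le> q \<Longrightarrow> q \<le> length Z \<Longrightarrow> prefix_le p (insert_at q a Z) s = prefix_le p Z s"
  by (simp add: prefix_le_def insert_at_def min_def)

text \<open>Comparing \<open>s\<close> with \<open>Z ! p\<close> alone suffices on the right, since
  sortedness of \<open>Z\<close> carries the bound further. The comparison is conditional so that
  insertion at the end is covered.\<close>

lemma sorted_insert_at:
  assumes "sorted Z" and "prefix_le p Z s" and "p < length Z \<Longrightarrow> s \<le> Z ! p"
  shows "sorted (insert_at p s Z)"
proof -
  have "s \<le> a" if "a \<in> set (drop p Z)" for a
  proof -
    from that obtain k where k: "p + k < length Z" "a = Z ! (p + k)"
      by (metis add.commute in_set_conv_nth length_drop less_diff_conv nth_drop nat_le_linear
          drop_all empty_iff empty_set)
    with assms(3) have "s \<le> Z ! p" by simp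
    also have "\<dots> \<le> Z ! (p + k)" using assms(1) k(1) by (simp add: sorted_nth_mono)
    finally show ?thesis using k(2) by simp
  qed
  moreover have "sorted (take p Z @ drop p Z)" using assms(1) by simp
  ultimately show ?thesis
    using assms(2) unfolding insert_at_def sorted_append
    by (auto simp: prefix_le_def)
qed

lemma advance_properties:
  assumes "p \<le> length Z" and "prefix_le p Z s"
  defines "q \<equiv> advance Z s p"
  shows "p \<le> q" and "q \<le> length Z" and "prefix_le q Z s" and "q < length Z \<Longrightarrow> s < Z ! q"
proof -
  \<comment> \<open>The first three conjuncts are the loop invariant; the last is the failed loop
    test at exit.\<close>
  have "p \<le> q \<and> q \<le> length Z \<and> prefix_le q Z s \<and> (q < length Z \<longrightarrow> s < Z ! q)"
    unfolding q_def advance_def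
    by (rule while_rule[where P = "\<lambda>c. p \<le> c \<and> c \<le> length Z \<and> prefix_le c Z s"
          and r = "measure (\<lambda>c. length Z - c)"])
      (use assms in \<open>auto intro: prefix_le_Suc\<close>)
  then show "p \<le> q" and "q \<le> length Z" and "prefix_le q Z s" and "q < length Z \<Longrightarrow> s < Z ! q"
    by auto
qed

text \<open>The strictness in \<open>i < i'\<close> for the prefix of \<open>ip\<close> anticipates the row change.\<close>

lemma inner_loop:
  assumes "length x = n" and "length y = n" and "sorted x" and "sorted y" and "i < n"
    and low: "low = map (\<lambda>i. x ! i + y ! 0) [0..<n]"
    and Z: "sorted Z" and ip: "ip \<le> length Z"
    and pre: "\<And>i'. i \<le> i' \<Longrightarrow> i' < n \<Longrightarrow> prefix_le ip Z (low ! i')"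
    and "m \<le> n"
    and run: "fold (inner_step n x y low i) [0..<m] (Z, ip, ip) = (Z', ip', cp')"
  shows "sorted Z' \<and> mset Z' = mset Z + image_mset (\<lambda>j. x ! i + y ! j) (mset_set {0..<m})
    \<and> ip' \<le> cp' \<and> cp' \<le> length Z'
    \<and> (\<forall>j. m \<le> j \<and> j < n \<longrightarrow> prefix_le cp' Z' (x ! i + y ! j))
    \<and> (\<forall>i'. i < i' \<and> i' < n \<longrightarrow> prefix_le ip' Z' (low ! i'))"
  using \<open>m \<le> n\<close> run
proof (induction m arbitrary: Z' ip' cp')
  case 0
  \<comment> \<open>Here \<open>cp\<close> starts at \<open>ip\<close>. The case
    \<open>i' = i\<close> of \<open>pre\<close> gives the bound for the first sum of the row, and
    sortedness of \<open>y\<close> passes it on to the others.\<close>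
  have "prefix_le ip Z (x ! i + y ! j)" if "j < n" for j
  proof -
    have "prefix_le ip Z (x ! i + y ! 0)" using pre[of i] \<open>i < n\<close> low by simp
    moreover have "y ! 0 \<le> y ! j" using assms(2,4) that by (simp add: sorted_nth_mono)
    ultimately show ?thesis by (auto intro: prefix_le_mono)
  qed
  with 0 Z ip pre show ?case by auto
next
  case (Suc m)
  obtain Z1 ip1 cp1 where run1: "fold (inner_step n x y low i) [0..<m] (Z, ip, ip) = (Z1, ip1, cp1)"
    by (metis prod_cases3)
  from Suc.IH[OF _ run1] Suc.prems(1) have IH: "sorted Z1"
    "mset Z1 = mset Z + image_mset (\<lambda>j. x ! i + y ! j) (mset_set {0..<m})"
    "ip1 \<le> cp1" "cp1 \<le> length Z1"
    "\<And>j. m \<le> j \<Longrightarrow> j < n \<Longrightarrow> prefix_le cp1 Z1 (x ! i + y ! j)"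
    "\<And>i'. i < i' \<Longrightarrow> i' < n \<Longrightarrow> prefix_le ip1 Z1 (low ! i')"
    by auto
  define s where "s = x ! i + y ! m"
  define q where "q = advance Z1 s cp1"
  have "prefix_le cp1 Z1 s" using IH(5)[of m] Suc.prems(1) by (simp add: s_def)
  note q = advance_properties[OF IH(4) this, folded q_def]
  have eqs: "Z' = insert_at q s Z1" "cp' = q"
    "ip' = (if i + 1 < n \<and> s \<le> low ! (i + 1) then q else ip1)"
  proof -
    have "inner_step n x y low i m (Z1, ip1, cp1) = (Z', ip', cp')"
      using Suc.prems(2) run1 by simp
    then show "Z' = insert_at q s Z1" "cp' = q"
      "ip' = (if i + 1 < n \<and> s \<le> low ! (i + 1) then q else ip1)"
      by (auto simp: inner_step_def Let_def s_def q_def)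
  qed
  have "sorted Z'" unfolding eqs using IH(1) q(3,4) by (auto intro: sorted_insert_at)
  \<comment> \<open>The new entry \<open>s\<close> sits at index \<open>q\<close>, just outside this
    prefix, whose entries are at most \<open>s\<close>.\<close>
  moreover have "prefix_le q Z' (x ! i + y ! j)" if "Suc m \<le> j" "j < n" for j
  proof -
    have "y ! m \<le> y ! j" using assms(2,4) that by (simp add: sorted_nth_mono)
    then show ?thesis unfolding eqs
      using q(2,3) by (auto simp: prefix_le_insert_at s_def intro: prefix_le_mono)
  qed
  moreover have "prefix_le ip' Z' (low ! i')" if "i < i'" "i' < n" for i'
  proof (cases "i + 1 < n \<and> s \<le> low ! (i + 1)")
    case True
    \<comment> \<open>The algorithm tests row \<open>i + 1\<close> only; sortedness of
      \<open>x\<close> extends the test to all later rows.\<close>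
    have "x ! (i + 1) \<le> x ! i'" using assms(1,3) that by (simp add: sorted_nth_mono)
    then have "low ! (i + 1) \<le> low ! i'" using low that by simp
    with True have "s \<le> low ! i'" by linarith
    then show ?thesis using True q(2,3) by (auto simp: eqs prefix_le_insert_at intro: prefix_le_mono)
  next
    case False
    \<comment> \<open>The pointer stays at \<open>ip1\<close>, and
      \<open>ip1 \<le> cp1 \<le> q\<close> puts the insertion at or behind it.\<close>
    then show ?thesis using IH(3) IH(6)[OF that] q(1,2)
      by (auto simp: eqs prefix_le_insert_at)
  qed
  ultimately show ?case
    using IH(2,3) q(1,2) by (auto simp: eqs s_def atLeast0_lessThan_Suc)
qed

text \<open>One pass of the outer loop contributes one row of the index grid; disjointness from the
  earlier rows turns the set union into a multiset sum.\<close>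

lemma mset_set_Suc_times:
  assumes "finite B"
  shows "mset_set ({0..<Suc i} \<times> B) = mset_set ({0..<i} \<times> B) + image_mset (Pair i) (mset_set B)"
proof -
  have "{0..<Suc i} \<times> B = {0..<i} \<times> B \<union> Pair i ` B"
    by (auto simp: less_Suc_eq)
  moreover have "{0..<i} \<times> B \<inter> Pair i ` B = {}" by auto
  ultimately show ?thesis
    using assms by (simp add: mset_set_Union image_mset_mset_set inj_on_def)
qed

text \<open>The prefix bound from row \<open>m\<close> on is what \<open>inner_loop\<close> requires
  on entering row \<open>m\<close>. It hands back the bound for rows beyond \<open>m\<close>, which
  is the invariant at \<open>Suc m\<close>.\<close>

lemma outer_loop:
  assumes "length x = n" and "length y = n" and "sorted x" and "sorted y"
    and low: "low = map (\<lambda>i. x ! i + y ! 0) [0..<n]"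
    and "m \<le> n"
    and run: "fold (row_step n x y low) [0..<m] ([], 0) = (Z, ip)"
  shows "sorted Z \<and> mset Z = {# x ! i + y ! j. (i, j) \<in># mset_set ({0..<m} \<times> {0..<n}) #}
    \<and> ip \<le> length Z
    \<and> (\<forall>i. m \<le> i \<and> i < n \<longrightarrow> prefix_le ip Z (low ! i))"
  using \<open>m \<le> n\<close> run
proof (induction m arbitrary: Z ip)
  case 0
  then show ?case by simp
next
  case (Suc m)
  obtain Z1 ip1 where run1: "fold (row_step n x y low) [0..<m] ([], 0) = (Z1, ip1)"
    by (metis surj_pair)
  \<comment> \<open>\<open>row_step\<close> drops the final \<open>cp\<close>, so it is recovered
    here as a witness.\<close>
  obtain cp where run2: "fold (inner_step n x y low m) [0..<n] (Z1, ip1, ip1) = (Z, ip, cp)"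
  proof -
    have "row_step n x y low m (Z1, ip1) = (Z, ip)"
      using Suc.prems(2) run1 by simp
    then show ?thesis
      using that by (auto simp: row_step_def split: prod.splits)
  qed
  from Suc.IH[OF _ run1] Suc.prems(1) have IH: "sorted Z1"
    "mset Z1 = {# x ! i + y ! j. (i, j) \<in># mset_set ({0..<m} \<times> {0..<n}) #}"
    "ip1 \<le> length Z1" "\<And>i. m \<le> i \<Longrightarrow> i < n \<Longrightarrow> prefix_le ip1 Z1 (low ! i)"
    by auto
  have "m < n" using Suc.prems(1) by simp
  from inner_loop[OF assms(1-4) this low IH(1,3,4) order.refl run2] IH(2)
  show ?case
    by (auto simp: mset_set_Suc_times image_mset.compositionality comp_def)
qed

theorem mainTheorem10:
  fixes n :: nat and x y :: "real list"
  assumes "length x = n" and "length y = n"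
    and "sorted x" and "sorted y"
  shows "mset (sumset_sort n x y) =
           {# x ! i + y ! j. (i, j) \<in># mset_set ({0..<n} \<times> {0..<n}) #}
       \<and> length (sumset_sort n x y) = n ^ 2
       \<and> sorted (sumset_sort n x y)"
proof -
  define low where "low = map (\<lambda>i. x ! i + y ! 0) [0..<n]"
  obtain Z ip where run: "fold (row_step n x y low) [0..<n] ([], 0) = (Z, ip)"
    by (metis surj_pair)
  have eq: "sumset_sort n x y = Z"
    using run by (simp add: sumset_sort_def low_def)
  have *: "sorted Z" "mset Z = {# x ! i + y ! j. (i, j) \<in># mset_set ({0..<n} \<times> {0..<n}) #}"
    using outer_loop[OF assms low_def order.refl run] by auto
  \<comment> \<open>Equal sums count with multiplicity, so the size is that of the index
    grid.\<close>
  from arg_cong[OF *(2), of size] have "length Z = n ^ 2"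
    by (simp add: power2_eq_square)
  with * show ?thesis by (simp add: eq)
qed

end
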